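(* For each positive integer $n$, let $G_n$ be a finite abelian group of order $n$, and let $k = k(n)$ be a function of $n$ satisfying $4 \le k(n) \le \lfloor n/2 \rfloor + 1$ for all $n$. For $b \in G_n$, let $N(k,b)$ denote the number of $k$-element subsets of $G_n$ whose elements sum to $b$ (in $G_n$). Then $$\lim_{n\to\infty} \frac{\min_{b\in G_n} |N(k,b)|}{\max_{b\in G_n} |N(k,b)|} = 1.$$
   Context: A $k$-subset of a set is a subset with exactly $k$ elements. The group operation of the abelian group $G_n$ is written additively, and the sum of a subset is the sum of its elements in $G_n$. *)

theory Defs
  imports Complex_Main "HOL-Algebra.Algebra"
begin

(* HOL-Algebra writes the operation of a comm_group multiplicatively, so the sum of the
   elements of S is the finite product of the identity function over S. *)
definition num_subsets_with_sum :: "('a, 'm) monoid_scheme \<Rightarrow> nat \<Rightarrow> 'a \<Rightarrow> nat" where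
  "num_subsets_with_sum G k b =
     card {S. S \<subseteq> carrier G \<and> finite S \<and> card S = k \<and> finprod G (\<lambda>x. x) S = b}"

end

theory Submission imports Defs "HOL-Real_Asymp.Real_Asymp"
begin

text \<open>
  Write \<open>N(k,b)\<close> for the number of \<open>k\<close>-subsets with sum \<open>b\<close>, and \<open>osc\<close> for the oscillation over
  \<open>b\<close>. Newton's identities in the group ring express \<open>k N(k,b)\<close> as the alternating sum over \<open>j \<ge> 1\<close>
  of \<open>\<Sum>\<^sub>g N(k - j, b - j g)\<close>. The term \<open>j = 1\<close> does not depend on \<open>b\<close>, so
  \<open>k osc N(k) \<le> n \<Sum>\<^bsub>i \<le> k - 2\<^esub> osc N(i)\<close>. The sequence \<open>E\<^sub>k\<close> with equality in this recursion has
  generating function \<open>(exp(-x) / (1 - x))^n\<close>. For \<open>k \<ge> n/4\<close>, evaluating it at \<open>r = k/n\<close> and using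
  that \<open>k\<close> is the mode of the binomial distribution with parameters \<open>n\<close>, \<open>k/n\<close> gives
  \<open>E\<^sub>k \<le> (n + 1) (e (1 - k/n))^(-k) (n choose k)\<close>, which is exponentially small relative to the
  binomial coefficient because \<open>e/2 > 1\<close>; for \<open>4 \<le> k \<le> n/4\<close> the recursion keeps
  \<open>E\<^sub>k / (n choose k) = O(n^(-2))\<close>. The maximum of \<open>N(k,b)\<close> is at least the average
  \<open>(n choose k) / n\<close>, so the ratio is at least \<open>1 - n E\<^sub>k / (n choose k)\<close>, which tends to 1.
\<close>

section \<open>The majorant of the oscillation\<close>

text \<open>These are the Taylor coefficients of \<open>F(x) = (exp(-x) / (1 - x))^n\<close>:
  comparing coefficients in \<open>(1 - x) F' = n x F\<close> gives the recursion.\<close>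

fun osc_bound :: "nat \<Rightarrow> nat \<Rightarrow> real" where
  "osc_bound n 0 = 1"
| "osc_bound n (Suc 0) = 0"
| "osc_bound n (Suc (Suc k)) =
     (real (Suc k) * osc_bound n (Suc k) + real n * osc_bound n k) / real (Suc (Suc k))"

lemma osc_bound_nonneg: "osc_bound n k \<ge> 0"
  by (induction n k rule: osc_bound.induct) auto

lemma osc_bound_rec:
  "real (Suc (Suc k)) * osc_bound n (Suc (Suc k)) =
     real (Suc k) * osc_bound n (Suc k) + real n * osc_bound n k"
  by (simp del: of_nat_Suc)

text \<open>Telescoping puts the recursion into the form that Newton's identities yield. The index
  \<open>m\<close> is left out because it belongs to the term \<open>j = 1\<close>, which does not
  oscillate.\<close>

lemma osc_bound_Suc: "real (Suc m) * osc_bound n (Suc m) = real n * (\<Sum>i<m. osc_bound n i)"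
proof (induction m)
  case (Suc m)
  show ?case
    unfolding osc_bound_rec Suc by (simp add: algebra_simps)
qed simp

text \<open>Truncating \<open>(1 - x) F' = n x F\<close> leaves three boundary terms, each
  subtracted and nonnegative for \<open>x >= 0\<close>. At \<open>k = 0\<close> the cut-off exponent
  \<open>k - 1\<close> does no harm, since the coefficient is 0.\<close>

lemma osc_bound_partial_sums:
  fixes x :: real
  shows "(1 - x) * (\<Sum>k\<le>Suc K. real k * osc_bound n k * x ^ (k - 1)) =
    real n * x * (\<Sum>k\<le>Suc K. osc_bound n k * x ^ k)
      - real n * osc_bound n (Suc K) * x ^ Suc (Suc K)
      - real n * osc_bound n K * x ^ Suc K
      - real (Suc K) * osc_bound n (Suc K) * x ^ Suc K"
proof (induction K)
  case (Suc K)
  define a b c where "a = osc_bound n K" and "b = osc_bound n (Suc K)"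
    and "c = osc_bound n (Suc (Suc K))"
  have rec: "real (Suc (Suc K)) * c = real (Suc K) * b + real n * a"
    unfolding a_def b_def c_def by (rule osc_bound_rec)
  have "(1 - x) * (\<Sum>k\<le>Suc (Suc K). real k * osc_bound n k * x ^ (k - 1)) =
     real n * x * (\<Sum>k\<le>Suc K. osc_bound n k * x ^ k)
      - real n * b * x ^ Suc (Suc K) - real n * a * x ^ Suc K
      - real (Suc K) * b * x ^ Suc K + (1 - x) * (real (Suc (Suc K)) * c * x ^ Suc K)"
    using Suc unfolding a_def b_def c_def by (simp add: distrib_left)
  also have "\<dots> = real n * x * (\<Sum>k\<le>Suc K. osc_bound n k * x ^ k)
      - real n * b * x ^ Suc (Suc K) - (real (Suc (Suc K)) * c) * x ^ Suc (Suc K)"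
    unfolding rec by (simp add: algebra_simps)
  also have "\<dots> = real n * x * (\<Sum>k\<le>Suc (Suc K). osc_bound n k * x ^ k)
      - real n * c * x ^ Suc (Suc (Suc K)) - real n * b * x ^ Suc (Suc K)
      - real (Suc (Suc K)) * c * x ^ Suc (Suc K)"
    unfolding sum.atMost_Suc[of _ "Suc K"] c_def[symmetric] by (simp add: algebra_simps)
  finally show ?case unfolding b_def c_def .
qed simp

text \<open>The partial sums \<open>P\<close> of the generating function satisfy \<open>(1 - x) P' \<le> n x P\<close>, so
  \<open>P(x) exp(n x) (1 - x)^n\<close> decreases.\<close>

lemma osc_bound_generating_function:
  fixes r :: real
  assumes r: "0 \<le> r" "r < 1" and n: "n > 0"
  shows "osc_bound n k * r ^ k * (1 - r) ^ n \<le> exp (- real n * r)"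
proof -
  define P where "P x = (\<Sum>i\<le>Suc k. osc_bound n i * x ^ i)" for x :: real
  define P' where "P' x = (\<Sum>i\<le>Suc k. real i * osc_bound n i * x ^ (i - 1))" for x :: real
  define F where "F x = P x * exp (real n * x) * (1 - x) ^ n" for x
  have dP: "(P has_real_derivative P' x) (at x)" for x
    unfolding P_def P'_def
    by (auto intro!: derivative_eq_intros sum.cong simp: mult_ac simp del: sum.atMost_Suc)
  have dF: "(F has_real_derivative
      exp (real n * x) * (1 - x) ^ (n - 1) * ((1 - x) * P' x - real n * x * P x)) (at x)" for x
  proof -
    have pw: "(1 - x) ^ n = (1 - x) * (1 - x) ^ (n - 1)"
      using n by (cases n) auto
    show ?thesis
      unfolding F_def
      by (rule derivative_eq_intros dP refl)+ (simp add: pw algebra_simps)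
  qed
  have neg: "(1 - x) * P' x - real n * x * P x \<le> 0" if "0 \<le> x" for x
  proof -
    have "0 \<le> real n * osc_bound n (Suc k) * x ^ Suc (Suc k)"
      "0 \<le> real n * osc_bound n k * x ^ Suc k"
      "0 \<le> real (Suc k) * osc_bound n (Suc k) * x ^ Suc k"
      using that by (auto intro!: mult_nonneg_nonneg osc_bound_nonneg)
    then show ?thesis
      unfolding P_def P'_def osc_bound_partial_sums by linarith
  qed
  have "F r \<le> F 0"
  proof (rule DERIV_nonpos_imp_nonincreasing[OF r(1)])
    fix x assume x: "0 \<le> x" "x \<le> r"
    have "exp (real n * x) * (1 - x) ^ (n - 1) * ((1 - x) * P' x - real n * x * P x) \<le> 0"
      using x r neg[OF x(1)] by (intro mult_nonneg_nonpos) auto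
    with dF show "\<exists>y. DERIV F x :> y \<and> y \<le> 0" by blast
  qed
  also have "F 0 = 1"
    unfolding F_def P_def sum.atMost_shift by simp
  finally have F: "P r * (1 - r) ^ n \<le> exp (- real n * r)"
    unfolding F_def by (simp add: exp_minus field_simps)
  have "osc_bound n k * r ^ k \<le> P r"
    unfolding P_def using r osc_bound_nonneg
    by (intro member_le_sum[of k "{..Suc k}" "\<lambda>i. osc_bound n i * r ^ i"]) auto
  then show ?thesis
    using F r by (meson mult_right_mono order_trans zero_le_power diff_ge_0_iff_ge less_imp_le)
qed

section \<open>Comparison of the majorant with the binomial coefficient\<close>

lemma Suc_times_binomial_Suc: "Suc i * (n choose Suc i) = (n - i) * (n choose i)"
  by (metis binomial_absorb_comp binomial_absorption mult.commute)

text \<open>The binomial theorem splits \<open>n^n = (k + (n - k))^n\<close> into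
  \<open>n + 1\<close> terms. The ratio of successive terms
  \<open>(n - i) k / ((i + 1) (n - k))\<close> is at least 1 for \<open>i < k\<close> and at most 1
  afterwards, so the term at \<open>k\<close> is the largest.\<close>

lemma binomial_mode:
  fixes n k :: nat
  assumes "0 < k" "k < n"
  shows "n ^ n \<le> (n + 1) * ((n choose k) * k ^ k * (n - k) ^ (n - k))"
proof -
  define t where "t i = (n choose i) * k ^ i * (n - k) ^ (n - i)" for i
  have sum_t: "n ^ n = (\<Sum>i\<le>n. t i)"
    using binomial[of k "n - k" n] assms by (simp add: t_def)
  have step: "t i = (n choose i) * (n - k) * (k ^ i * (n - k) ^ (n - Suc i))"
    "t (Suc i) = (n choose Suc i) * k * (k ^ i * (n - k) ^ (n - Suc i))" if "i < n" for i
    using that unfolding t_def by (simp_all add: Suc_diff_Suc flip: power_Suc)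
  have up: "t i \<le> t (Suc i)" if "i < k" for i
  proof -
    have "Suc i * ((n choose i) * (n - k)) \<le> (n - i) * (n choose i) * k"
    proof -
      have "Suc i * (n - k) \<le> k * (n - i)"
        using that by (intro mult_le_mono) auto
      from mult_le_mono2[OF this, of "n choose i"] show ?thesis
        by (simp only: mult_ac)
    qed
    also have "\<dots> = Suc i * ((n choose Suc i) * k)"
      by (simp only: Suc_times_binomial_Suc[symmetric] mult.assoc)
    finally have "(n choose i) * (n - k) \<le> (n choose Suc i) * k"
      using Suc_mult_le_cancel1 by blast
    then show ?thesis
      using that assms step[of i] by simp
  qed
  have down: "t (Suc i) \<le> t i" if "k \<le> i" "i < n" for i
  proof -
    have "Suc i * ((n choose Suc i) * k) = (n - i) * (n choose i) * k"
      by (simp only: Suc_times_binomial_Suc[symmetric] mult.assoc)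
    also have "\<dots> \<le> Suc i * ((n choose i) * (n - k))"
    proof -
      have "k * (n - i) \<le> Suc i * (n - k)"
        using that by (intro mult_le_mono) auto
      from mult_le_mono2[OF this, of "n choose i"] show ?thesis
        by (simp only: mult_ac)
    qed
    finally have "(n choose Suc i) * k \<le> (n choose i) * (n - k)"
      using Suc_mult_le_cancel1 by blast
    then show ?thesis
      using that step[of i] by simp
  qed
  have "t i \<le> t k" if "i \<le> n" for i
  proof (cases "i \<le> k")
    case True
    then show ?thesis
      by (induction rule: inc_induct) (use up le_trans in blast)+
  next
    case False
    then have "k \<le> i" by simp
    then show ?thesis using that
    proof (induction rule: dec_induct)
      case (step m)
      then show ?case using down[of m] by simp
    qed simp
  qed
  then have "(\<Sum>i\<le>n. t i) \<le> (n + 1) * t k"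
    using sum_bounded_above[of "{..n}" t "t k"] by simp
  then show ?thesis by (simp add: sum_t t_def)
qed

text \<open>The generating function bound carries \<open>(1 - r)^n\<close> and the mode bound only
  \<open>(1 - r)^(n - k)\<close>. The surplus \<open>(1 - r)^k\<close> in the denominator is
  outweighed by \<open>exp(-k)\<close>.\<close>

lemma osc_bound_le_large:
  assumes n: "n \<ge> 40" and k: "real n / 4 \<le> real k" "k \<le> n div 2 + 1"
  shows "osc_bound n k \<le> real (n + 1) * (17/20) powr (real n / 4) * real (n choose k)"
proof -
  define r where "r = real k / real n"
  have k0: "0 < k" "k < n" using n k by auto
  have rk: "real n * r = real k" using n by (simp add: r_def)
  \<comment> \<open>\<open>k <= n/2 + 1\<close> and \<open>n >= 40\<close> give
    \<open>r <= 1/2 + 1/40\<close>.\<close>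
  have r: "0 < r" "r \<le> 21/40"
    using n k k0 by (auto simp: r_def field_simps)
  have mode: "1 \<le> real (n + 1) * (real (n choose k) * r ^ k * (1 - r) ^ (n - k))"
  proof -
    have "real n ^ n \<le> real (n + 1) * (real (n choose k) * (real k ^ k * real (n - k) ^ (n - k)))"
      using of_nat_mono[OF binomial_mode[OF k0], where 'a = real]
      by (simp add: algebra_simps)
    also have "real k ^ k * real (n - k) ^ (n - k) = real n ^ n * (r ^ k * (1 - r) ^ (n - k))"
    proof -
      have "real k = real n * r" "real (n - k) = real n * (1 - r)"
        using rk k0 by (auto simp: algebra_simps)
      then have "real k ^ k * real (n - k) ^ (n - k)
          = real n ^ k * real n ^ (n - k) * (r ^ k * (1 - r) ^ (n - k))"
        by (simp add: power_mult_distrib)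
      then show ?thesis using k0 by (simp flip: power_add)
    qed
    finally have "real n ^ n * 1 \<le> real n ^ n * (real (n + 1) * (real (n choose k) * r ^ k * (1 - r) ^ (n - k)))"
      by (simp add: mult_ac)
    then show ?thesis
      using n by (subst (asm) mult_le_cancel_left_pos) auto
  qed
  \<comment> \<open>The constant works because
    \<open>e (1 - r) >= 5/2 * 19/40 = 19/16 > 20/17\<close>.\<close>
  have e: "1 \<le> 17/20 * (exp 1 * (1 - r))"
  proof -
    have "(5/2 :: real) \<le> exp 1"
      using exp_lower_Taylor_quadratic[of 1] by simp
    then have "(5/2) * (19/40) \<le> exp 1 * (1 - r)"
      using r by (intro mult_mono) auto
    then show ?thesis by simp
  qed
  define q where "q = r ^ k * (1 - r) ^ n"
  have q: "q > 0" using r by (simp add: q_def)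
  have "osc_bound n k * q \<le> exp (- real k)"
    using osc_bound_generating_function[of r n k] r n rk by (simp add: q_def mult_ac)
  also have "\<dots> = exp (- 1) ^ k"
    by (simp flip: exp_of_nat_mult)
  also have "\<dots> \<le> (17/20 * (1 - r)) ^ k"
    using e by (intro power_mono) (auto simp: exp_minus field_simps)
  also have "\<dots> = (17/20) ^ k * (1 - r) ^ k"
    by (rule power_mult_distrib)
  also have "\<dots> \<le> (17/20) powr (real n / 4) * (1 - r) ^ k"
    using k r by (intro mult_right_mono) (auto simp: powr_mono' simp flip: powr_realpow)
  also have "\<dots> \<le> (17/20) powr (real n / 4) * (1 - r) ^ k *
      (real (n + 1) * (real (n choose k) * r ^ k * (1 - r) ^ (n - k)))"
    using r by (intro mult_right_mono[OF mode, THEN order_trans[rotated]] 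
        order_trans[OF _ mult_left_mono[OF mode]]) auto
  also have "\<dots> = real (n + 1) * (17/20) powr (real n / 4) * real (n choose k) * 
      (r ^ k * ((1 - r) ^ k * (1 - r) ^ (n - k)))"
    by (simp add: mult_ac)
  also have "(1 - r) ^ k * (1 - r) ^ (n - k) = (1 - r) ^ n"
    using k0 by (simp flip: power_add)
  finally show ?thesis
    using q by (simp add: q_def[symmetric])
qed

text \<open>The recursion reaches back two steps, so \<open>k = 4\<close> and \<open>k = 5\<close>
  are base cases. The constant 64 comes from \<open>k = 4\<close>: the majorant is at most
  \<open>n^2/4\<close>, and the binomial coefficient is at least \<open>(n/4)^4\<close>.\<close>

lemma osc_bound_le_small:
  assumes n: "n \<ge> 40" and k: "4 \<le> k" "real k \<le> real n / 4"
  shows "osc_bound n k \<le> 64 / real n ^ 2 * real (n choose k)"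
  using k
proof (induction k rule: less_induct)
  case (less k)
  have E2: "osc_bound n 2 = real n / 2" and E3: "osc_bound n 3 = real n / 3"
    by (simp_all add: numeral_eq_Suc)
  have E4: "osc_bound n 4 = (real n + real n ^ 2 / 2) / 4"
    using osc_bound_rec[of 2 n] E2 E3 by (simp add: numeral_eq_Suc power2_eq_square field_simps)
  have E5: "osc_bound n 5 = (real n + 5 / 6 * real n ^ 2) / 5"
    using osc_bound_rec[of 3 n] E3 E4 by (simp add: numeral_eq_Suc power2_eq_square field_simps)
  consider "k = 4" | "k = 5" | "k \<ge> 6" using less.prems by linarith
  then show ?case
  proof cases
    case 1
    have "(real n / 4) ^ 4 \<le> real (n choose 4)"
      using binomial_ge_n_over_k_pow_k[of 4 n, where 'a = real] n by simp
    then have "64 / real n ^ 2 * (real n / 4) ^ 4 \<le> 64 / real n ^ 2 * real (n choose 4)"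
      by (intro mult_left_mono) auto
    moreover have "64 / real n ^ 2 * (real n / 4) ^ 4 = real n ^ 2 / 4"
      using n by (simp add: field_simps power2_eq_square power4_eq_xxxx)
    moreover have "2 * real n \<le> real n ^ 2"
      using n by (simp add: power2_eq_square)
    ultimately show ?thesis using 1 E4 by simp
  next
    case 2
    have "(real n / 5) ^ 5 \<le> real (n choose 5)"
      using binomial_ge_n_over_k_pow_k[of 5 n, where 'a = real] n by simp
    then have "64 / real n ^ 2 * (real n / 5) ^ 5 \<le> 64 / real n ^ 2 * real (n choose 5)"
      by (intro mult_left_mono) auto
    moreover have "64 / real n ^ 2 * (real n / 5) ^ 5 = 64 * real n * real n ^ 2 / 3125"
      using n by (simp add: field_simps numeral_eq_Suc)
    moreover have "40 * real n ^ 2 \<le> real n * real n ^ 2"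
      using n by (intro mult_right_mono) auto
    moreover have "40 * real n \<le> real n ^ 2"
      using n by (simp add: power2_eq_square)
    ultimately show ?thesis using 2 E5 by simp
  next
    case 3
    define j where "j = k - 2"
    have j: "k = Suc (Suc j)" "j \<ge> 4" using 3 by (auto simp: j_def)
    define M where "M = 64 / real n ^ 2"
    have M: "M \<ge> 0" by (simp add: M_def)
    define c where "c = real (n choose j)"
    have c: "c \<ge> 0" by (simp add: c_def)
    have jn: "4 * real j + 8 \<le> real n" using less.prems j by simp
    have absorb: "real (Suc i) * real (n choose Suc i) = (real n - real i) * real (n choose i)"
      if "i \<le> n" for i
      using arg_cong[OF Suc_times_binomial_Suc[of i n], of real] that
      unfolding of_nat_mult by (simp only: of_nat_diff)
    have c1: "real (j + 1) * real (n choose Suc j) = (real n - real j) * c"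
      using absorb[of j] jn by (simp add: c_def)
    have c2: "real (j + 2) * real (n choose k) = (real n - real (j + 1)) * real (n choose Suc j)"
      using absorb[of "Suc j"] jn j by simp
    have "osc_bound n (Suc j) \<le> M * real (n choose Suc j)" "osc_bound n j \<le> M * c"
      using less.IH[of "Suc j"] less.IH[of j] less.prems j by (auto simp: M_def c_def)
    then have "real (Suc j) * osc_bound n (Suc j) + real n * osc_bound n j
        \<le> real (Suc j) * (M * real (n choose Suc j)) + real n * (M * c)"
      by (intro add_mono mult_left_mono) auto
    also have "\<dots> = M * (real (j + 1) * real (n choose Suc j) + real n * c)"
      by (simp add: algebra_simps)
    also have "\<dots> = M * ((real n - real j) * c + real n * c)"
      by (simp only: c1)
    also have "\<dots> \<le> M * (real (j + 2) * real (n choose k))"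
    proof (intro mult_left_mono M)
      \<comment> \<open>The factor \<open>j + 1\<close> lets both binomial coefficients be reduced
        to \<open>c\<close>. What remains holds because \<open>j + 1 <= n/4\<close> and
        \<open>1/2 <= 9/16\<close>.\<close>
      have "real (j + 1) * ((2 * real n - real j) * c) \<le> (real n - real (j + 1)) * ((real n - real j) * c)"
      proof -
        have "real (j + 1) * (2 * real n - real j) \<le> (real n / 4) * (2 * real n)"
          using jn by (intro mult_mono) auto
        also have "\<dots> \<le> (3 * real n / 4) * (3 * real n / 4)" by simp
        also have "\<dots> \<le> (real n - real (j + 1)) * (real n - real j)"
          using jn by (intro mult_mono) auto
        finally show ?thesis
          unfolding mult.assoc[symmetric] by (rule mult_right_mono[OF _ c])
      qed
      also have "\<dots> = (real n - real (j + 1)) * (real (j + 1) * real (n choose Suc j))"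
        by (simp only: c1)
      also have "\<dots> = real (j + 1) * (real (j + 2) * real (n choose k))"
        by (simp only: c2 mult.left_commute)
      finally show "(real n - real j) * c + real n * c \<le> real (j + 2) * real (n choose k)"
        by (subst (asm) mult_le_cancel_left_pos) (auto simp: algebra_simps)
    qed
    also have "real (Suc j) * osc_bound n (Suc j) + real n * osc_bound n j
        = real (j + 2) * osc_bound n k"
      using osc_bound_rec[of j n] j by simp
    also have "M * (real (j + 2) * real (n choose k)) = real (j + 2) * (M * real (n choose k))"
      by simp
    finally show ?thesis
      unfolding M_def by (subst (asm) mult_le_cancel_left_pos) auto
  qed
qed

section \<open>Counting subsets by their sum\<close>

text \<open>The cardinality is the coefficient of \<open>b\<close> in the group ring product of the
  \<open>m\<close>-th elementary symmetric function and the \<open>j\<close>-th power sum of the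
  group elements.\<close>

definition pairs :: "('a, 'm) monoid_scheme \<Rightarrow> nat \<Rightarrow> nat \<Rightarrow> 'a \<Rightarrow> ('a set \<times> 'a) set" where
  "pairs G m j b = {(S, g). S \<subseteq> carrier G \<and> card S = m \<and> g \<in> carrier G \<and>
     finprod G (\<lambda>x. x) S \<otimes>\<^bsub>G\<^esub> g [^]\<^bsub>G\<^esub> j = b}"

definition pointed :: "('a, 'm) monoid_scheme \<Rightarrow> nat \<Rightarrow> nat \<Rightarrow> 'a \<Rightarrow> ('a set \<times> 'a) set" where
  "pointed G m j b = {p \<in> pairs G m j b. snd p \<in> fst p}"

locale finite_comm_group = comm_group +
  assumes fin: "finite (carrier G)"
begin

abbreviation "N \<equiv> num_subsets_with_sum G"
abbreviation "prd \<equiv> finprod G (\<lambda>x. x)"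

lemma finite_subset_carrier: "S \<subseteq> carrier G \<Longrightarrow> finite S"
  using fin finite_subset by blast

lemma prd_closed: "S \<subseteq> carrier G \<Longrightarrow> prd S \<in> carrier G"
  by (auto intro!: finprod_closed)

lemma num_subsets_eq: "N k b = card {S. S \<subseteq> carrier G \<and> card S = k \<and> prd S = b}"
  unfolding num_subsets_with_sum_def by (rule arg_cong[where f = card]) (auto simp: finite_subset_carrier)

lemma finite_pairs: "finite (pairs G m j b)"
  by (rule finite_subset[of _ "Pow (carrier G) \<times> carrier G"]) (auto simp: pairs_def fin)

text \<open>A pair \<open>(S, g)\<close> with \<open>g \<notin> S\<close> corresponds to \<open>(insert g S, g)\<close>, where one factor \<open>g\<close> has moved
  into the product; iterating this in \<open>m\<close> is Newton's identity.\<close>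

lemma card_pointed_Suc:
  "card (pointed G (Suc m) j b) + card (pointed G m (Suc j) b) = card (pairs G m (Suc j) b)"
proof -
  let ?out = "{p \<in> pairs G m (Suc j) b. snd p \<notin> fst p}"
  have "bij_betw (\<lambda>(S, g). (insert g S, g)) ?out (pointed G (Suc m) j b)"
  proof (rule bij_betw_byWitness[where f' = "\<lambda>(S, g). (S - {g}, g)"])
    have eq: "prd (insert g S) \<otimes> g [^] j = prd S \<otimes> g [^] Suc j"
      if "S \<subseteq> carrier G" "g \<in> carrier G" "g \<notin> S" for S g
    proof -
      have "prd (insert g S) = g \<otimes> prd S"
        using that finite_subset_carrier by (subst finprod_insert) auto
      then show ?thesis
        using that prd_closed[of S] by (simp add: m_ac)
    qed
    show "(\<lambda>(S, g). (insert g S, g)) ` ?out \<subseteq> pointed G (Suc m) j b"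
      using eq by (auto simp: pairs_def pointed_def finite_subset_carrier)
    show "(\<lambda>(S, g). (S - {g}, g)) ` pointed G (Suc m) j b \<subseteq> ?out"
    proof clarsimp
      fix S g assume "(S, g) \<in> pointed G (Suc m) j b"
      then have *: "S \<subseteq> carrier G" "card S = Suc m" "g \<in> S" "prd S \<otimes> g [^] j = b"
        by (auto simp: pairs_def pointed_def)
      with eq[of "S - {g}" g] have "prd (S - {g}) \<otimes> g [^] Suc j = b"
        by (auto simp: insert_absorb subset_iff)
      with * show "(S - {g}, g) \<in> pairs G m (Suc j) b"
        by (auto simp: pairs_def finite_subset_carrier)
    qed
  qed (auto simp: pointed_def)
  then have "card (pointed G (Suc m) j b) = card ?out"
    by (simp add: bij_betw_same_card)
  also have "card ?out + card (pointed G m (Suc j) b) = card (?out \<union> pointed G m (Suc j) b)"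
    using finite_pairs by (intro card_Un_disjoint[symmetric]) (auto simp: pointed_def)
  also have "?out \<union> pointed G m (Suc j) b = pairs G m (Suc j) b"
    by (auto simp: pointed_def)
  finally show ?thesis .
qed

lemma card_pointed_0: "card (pointed G 0 j b) = 0"
proof -
  have "pointed G 0 j b = {}"
    by (auto simp: pointed_def pairs_def finite_subset_carrier)
  then show ?thesis by simp
qed

text \<open>With exponent 0 the marked element leaves the product unchanged, so each
  \<open>S\<close> is counted once per element. This is the side \<open>k N(k,b)\<close> of Newton's
  identity.\<close>

lemma card_pointed_exponent_0: "card (pointed G m 0 b) = m * N m b"
proof -
  have "pointed G m 0 b = (SIGMA S:{S. S \<subseteq> carrier G \<and> card S = m \<and> prd S = b}. S)"
    by (auto simp: pointed_def pairs_def prd_closed)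
  also have "card \<dots> = (\<Sum>S\<in>{S. S \<subseteq> carrier G \<and> card S = m \<and> prd S = b}. card S)"
    using fin by (intro card_SigmaI) (auto simp: finite_subset_carrier intro: finite_subset[of _ "Pow (carrier G)"])
  also have "\<dots> = m * N m b"
    by (simp add: num_subsets_eq)
  finally show ?thesis .
qed

lemma card_pairs:
  assumes b: "b \<in> carrier G"
  shows "card (pairs G m j b) = (\<Sum>g\<in>carrier G. N m (b \<otimes> inv (g [^] j)))"
proof -
  let ?T = "\<lambda>g. {S. S \<subseteq> carrier G \<and> card S = m \<and> prd S = b \<otimes> inv (g [^] j)}"
  have "bij_betw (\<lambda>(S, g). (g, S)) (pairs G m j b) (SIGMA g:carrier G. ?T g)"
  proof (rule bij_betw_byWitness[where f' = "\<lambda>(g, S). (S, g)"])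
    have "prd S \<otimes> g [^] j = b \<longleftrightarrow> prd S = b \<otimes> inv (g [^] j)"
      if "S \<subseteq> carrier G" "g \<in> carrier G" for S g
      using that b prd_closed[of S] inv_solve_right[of "prd S" b "g [^] j"] by auto
    then show "(\<lambda>(S, g). (g, S)) ` pairs G m j b \<subseteq> (SIGMA g:carrier G. ?T g)"
      "(\<lambda>(g, S). (S, g)) ` (SIGMA g:carrier G. ?T g) \<subseteq> pairs G m j b"
      by (auto simp: pairs_def)
  qed auto
  then have "card (pairs G m j b) = card (SIGMA g:carrier G. ?T g)"
    by (rule bij_betw_same_card)
  also have "\<dots> = (\<Sum>g\<in>carrier G. card (?T g))"
    using fin by (intro card_SigmaI) (auto intro: finite_subset[of _ "Pow (carrier G)"])
  finally show ?thesis by (simp add: num_subsets_eq)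
qed

lemma sum_num_subsets: "(\<Sum>b\<in>carrier G. N m b) = order G choose m"
proof -
  have "(\<Sum>b\<in>carrier G. N m b) = card (\<Union>b\<in>carrier G. {S. S \<subseteq> carrier G \<and> card S = m \<and> prd S = b})"
    unfolding num_subsets_eq using fin
    by (intro card_UN_disjoint[symmetric]) (auto intro: finite_subset[of _ "Pow (carrier G)"])
  also have "(\<Union>b\<in>carrier G. {S. S \<subseteq> carrier G \<and> card S = m \<and> prd S = b}) = {S. S \<subseteq> carrier G \<and> card S = m}"
    by (auto simp: prd_closed)
  finally show ?thesis by (simp add: n_subsets fin order_def)
qed

text \<open>As \<open>g\<close> runs through the group, so does \<open>b \<otimes> inv g\<close>;
  hence the count is the number of all \<open>m\<close>-subsets, whatever \<open>b\<close>
  is.\<close>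

lemma card_pairs_exponent_1:
  assumes b: "b \<in> carrier G"
  shows "card (pairs G m (Suc 0) b) = order G choose m"
proof -
  have "bij_betw (\<lambda>g. b \<otimes> inv g) (carrier G) (carrier G)"
    by (rule bij_betw_byWitness[where f' = "\<lambda>g. inv g \<otimes> b"])
      (use b in \<open>auto simp: inv_mult_group m_ac m_assoc[symmetric]\<close>)
  then show ?thesis
    using sum.reindex_bij_betw[of "\<lambda>g. b \<otimes> inv g" "carrier G" "carrier G" "N m"] b
    by (simp add: card_pairs sum_num_subsets)
qed

definition osc_le :: "('a \<Rightarrow> nat) \<Rightarrow> real \<Rightarrow> bool" where
  "osc_le f e \<longleftrightarrow> (\<forall>b\<in>carrier G. \<forall>b'\<in>carrier G. \<bar>real (f b) - real (f b')\<bar> \<le> e)"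

text \<open>For each \<open>g\<close> the count is \<open>N m\<close> at a translate of
  \<open>b\<close>, which costs at most \<open>e\<close>; there are \<open>order G\<close> choices
  of \<open>g\<close>.\<close>

lemma osc_le_pairs:
  fixes e :: real
  assumes "osc_le (N m) e"
  shows "osc_le (\<lambda>b. card (pairs G m j b)) (order G * e)"
  unfolding osc_le_def
proof (intro ballI)
  fix b b' assume b: "b \<in> carrier G" "b' \<in> carrier G"
  have "real (card (pairs G m j b)) - real (card (pairs G m j b'))
      = (\<Sum>g\<in>carrier G. real (N m (b \<otimes> inv (g [^] j))) - real (N m (b' \<otimes> inv (g [^] j))))"
    using b by (simp add: card_pairs sum_subtractf)
  also have "\<bar>\<dots>\<bar> \<le> (\<Sum>g\<in>carrier G. e)"
    using assms b unfolding osc_le_def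
    by (intro order_trans[OF sum_abs] sum_mono) auto
  finally show "\<bar>real (card (pairs G m j b)) - real (card (pairs G m j b'))\<bar> \<le> order G * e"
    by (simp add: order_def)
qed

lemma osc_le_pointed_Suc:
  fixes d e :: real
  assumes "osc_le (\<lambda>b. card (pairs G m (Suc j) b)) d"
    and "osc_le (\<lambda>b. card (pointed G m (Suc j) b)) e"
  shows "osc_le (\<lambda>b. card (pointed G (Suc m) j b)) (d + e)"
  unfolding osc_le_def
proof (intro ballI)
  fix b b' assume b: "b \<in> carrier G" "b' \<in> carrier G"
  then have "\<bar>real (card (pairs G m (Suc j) b)) - real (card (pairs G m (Suc j) b'))\<bar> \<le> d"
    "\<bar>real (card (pointed G m (Suc j) b)) - real (card (pointed G m (Suc j) b'))\<bar> \<le> e"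
    using assms unfolding osc_le_def by auto
  then show "\<bar>real (card (pointed G (Suc m) j b)) - real (card (pointed G (Suc m) j b'))\<bar> \<le> d + e"
    using card_pointed_Suc[of m j b, symmetric] card_pointed_Suc[of m j b', symmetric] by simp
qed

lemma osc_le_pointed:
  fixes e :: "nat \<Rightarrow> real"
  assumes "\<And>i. i < m \<Longrightarrow> osc_le (N i) (e i)"
  shows "osc_le (\<lambda>b. card (pointed G m j b)) (order G * (\<Sum>i<m. e i))"
  using assms
\<comment> \<open>The exponent rises by one whenever \<open>m\<close> drops by one.\<close>
proof (induction m arbitrary: j)
  case 0
  show ?case by (simp add: osc_le_def card_pointed_0)
next
  case (Suc m)
  then have "osc_le (\<lambda>b. card (pointed G (Suc m) j b)) (order G * e m + order G * (\<Sum>i<m. e i))"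
    by (intro osc_le_pointed_Suc osc_le_pairs) auto
  then show ?case by (simp add: algebra_simps)
qed

lemma osc_le_num_subsets: "osc_le (N k) (osc_bound (order G) k)"
proof (induction k rule: less_induct)
  case (less k)
  show ?case
  proof (cases k)
    case 0
    have "N 0 b = (if b = \<one> then 1 else 0)" for b
    proof -
      have "{S. S \<subseteq> carrier G \<and> card S = 0 \<and> prd S = b} = (if b = \<one> then {{}} else {})"
        by (auto simp: finite_subset_carrier)
      then show ?thesis by (simp add: num_subsets_eq)
    qed
    then show ?thesis using 0 by (simp add: osc_le_def)
  next
    case (Suc m)
    \<comment> \<open>The first Newton step is split off: its pairs have exponent 1 and contribute
      0, so the sum stops below \<open>m\<close>.\<close>
    have "osc_le (\<lambda>b. card (pointed G (Suc m) 0 b)) (0 + order G * (\<Sum>i<m. osc_bound (order G) i))"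
      using less.IH Suc
      by (intro osc_le_pointed_Suc osc_le_pointed) (auto simp: osc_le_def card_pairs_exponent_1)
    then have *: "osc_le (\<lambda>b. card (pointed G (Suc m) 0 b)) (real (Suc m) * osc_bound (order G) (Suc m))"
      unfolding osc_bound_Suc by simp
    have "\<bar>real (N k b) - real (N k b')\<bar> \<le> osc_bound (order G) k"
      if "b \<in> carrier G" "b' \<in> carrier G" for b b'
    proof -
      have "real (Suc m) * \<bar>real (N k b) - real (N k b')\<bar>
          = \<bar>real (card (pointed G (Suc m) 0 b)) - real (card (pointed G (Suc m) 0 b'))\<bar>"
        unfolding card_pointed_exponent_0 Suc of_nat_mult right_diff_distrib[symmetric] abs_mult
        by simp
      also have "\<dots> \<le> real (Suc m) * osc_bound (order G) k"
        using * that Suc unfolding osc_le_def by blast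
      finally show ?thesis by (subst (asm) mult_le_cancel_left_pos) auto
    qed
    then show ?thesis by (simp add: osc_le_def)
  qed
qed

text \<open>The maximum is at least the average \<open>(n choose k) / n\<close> with
  \<open>n = order G\<close>, so a gap of at most \<open>c (n choose k)\<close> is at most
  \<open>n c\<close> times the maximum.\<close>

lemma Min_div_Max_num_subsets:
  fixes k :: nat and c q :: real
  defines "q \<equiv> real (Min (N k ` carrier G)) / real (Max (N k ` carrier G))"
  assumes k: "k \<le> order G" and c: "osc_bound (order G) k \<le> c * real (order G choose k)"
  shows "1 - order G * c \<le> q" "q \<le> 1"
proof -
  let ?A = "N k ` carrier G"
  have A: "finite ?A" "?A \<noteq> {}" using fin by auto
  obtain b where b: "b \<in> carrier G" "Max ?A = N k b" using Max_in[OF A] by auto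
  obtain b' where b': "b' \<in> carrier G" "Min ?A = N k b'" using Min_in[OF A] by auto
  have "order G choose k \<le> order G * Max ?A"
    using sum_bounded_above[of "carrier G" "N k" "Max ?A"] A
    by (simp add: sum_num_subsets order_def)
  then have max: "real (order G choose k) \<le> order G * real (Max ?A)"
    by (metis of_nat_le_iff of_nat_mult)
  have ch: "real (order G choose k) > 0" using k by simp
  have pos: "real (Max ?A) > 0"
    using max ch by (metis mult_zero_right not_le of_nat_0_less_iff of_nat_0 gr0I)
  have "0 \<le> c * real (order G choose k)" using c osc_bound_nonneg[of "order G" k] by linarith
  then have c0: "c \<ge> 0" using ch by (simp add: zero_le_mult_iff)
  have "real (Max ?A) - real (Min ?A) \<le> osc_bound (order G) k"
    using osc_le_num_subsets[of k] b b' unfolding osc_le_def by force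
  also have "\<dots> \<le> c * (order G * real (Max ?A))"
    using c mult_left_mono[OF max c0] by linarith
  finally show "1 - order G * c \<le> q"
    using pos by (simp add: q_def field_simps)
  show "q \<le> 1"
    using pos Min_le_iff[OF A] Max_in[OF A] by (auto simp: q_def)
qed

end

theorem theorem1:
  fixes G :: "nat \<Rightarrow> ('a, 'm) monoid_scheme" and k :: "nat \<Rightarrow> nat"
  assumes "\<And>n. n \<ge> 1 \<Longrightarrow> comm_group (G n)"
    and "\<And>n. n \<ge> 1 \<Longrightarrow> finite (carrier (G n))"
    and "\<And>n. n \<ge> 1 \<Longrightarrow> order (G n) = n"
    and "\<And>n. n \<ge> 6 \<Longrightarrow> 4 \<le> k n \<and> k n \<le> n div 2 + 1"
  shows "(\<lambda>n. real (Min (num_subsets_with_sum (G n) (k n) ` carrier (G n))) /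
              real (Max (num_subsets_with_sum (G n) (k n) ` carrier (G n)))) \<longlonglongrightarrow> 1"
    (is "?q \<longlonglongrightarrow> 1")
proof (rule tendsto_sandwich)
  \<comment> \<open>Adding the bounds for small and large \<open>k\<close> gives one error term that
    does not depend on \<open>k n\<close>.\<close>
  define c where "c n = 64 / real n ^ 2 + real (n + 1) * (17/20) powr (real n / 4)" for n
  have q: "1 - real n * c n \<le> ?q n" "?q n \<le> 1" if n: "n \<ge> 40" for n
  proof -
    interpret finite_comm_group "G n"
      using assms(1,2)[of n] n unfolding finite_comm_group_def finite_comm_group_axioms_def by simp
    have ord: "order (G n) = n" and k: "4 \<le> k n" "k n \<le> n div 2 + 1"
      using assms(3,4)[of n] n by auto
    have "osc_bound n (k n) \<le> 64 / real n ^ 2 * real (n choose k n)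
        \<or> osc_bound n (k n) \<le> real (n + 1) * (17/20) powr (real n / 4) * real (n choose k n)"
      using osc_bound_le_small[OF n] osc_bound_le_large[OF n] k by (meson linear)
    then have "osc_bound n (k n) \<le> c n * real (n choose k n)"
      unfolding c_def distrib_right
      by (elim disjE order_trans) (simp_all add: add_increasing add_increasing2)
    then show "1 - real n * c n \<le> ?q n" "?q n \<le> 1"
      using Min_div_Max_num_subsets[of "k n" "c n"] k n by (auto simp: ord)
  qed
  show "\<forall>\<^sub>F n in sequentially. 1 - real n * c n \<le> ?q n" "\<forall>\<^sub>F n in sequentially. ?q n \<le> 1"
    using q by (auto intro!: eventually_sequentiallyI[of 40])
  show "(\<lambda>n. 1 - real n * c n) \<longlonglongrightarrow> 1"
    \<comment> \<open>\<open>n * c n\<close> is \<open>64/n\<close> plus a polynomial times an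
      exponentially decaying factor.\<close>
    unfolding c_def by real_asymp
qed simp

end
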